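(* Let $Q$ be a quasi-category, $p\colon\tilde J\to J$ a map of simplicial sets, and $d\colon J\to Q$ a diagram. The limit of $d$ weighted by $p$ is the limit of the diagram $d\circ p\colon\tilde J\xrightarrow{p}J\xrightarrow{d}Q$, i.e. $$\lim{}^pd\simeq\lim(d\circ p).$$
   Context: For a simplicial set $I$, the weighted join is the pushout $I\star^pJ:=(I\star\tilde J)\amalg_{\tilde J}J$ along $p$ of the canonical map $\tilde J\to I\star\tilde J$ into Joyal's join, where $(I\star \tilde J)_n=I_n\amalg \tilde J_n\amalg\coprod_{i=0}^{n-1}(I_i\times \tilde J_{n-1-i})$. The quasi-category $Q^p_{/d}$ of weighted cones over $d\colon J\to Q$ has as $n$-simplices the maps $\Delta[n]\star^pJ\to Q$ restricting to $d$ on $J$ (the value at $d$ of the right adjoint of $(-)\star^pJ\colon\mathrm{sSet}\to{}^{J/}\mathrm{sSet}$). A vertex $t$ of a quasi-category $X$ is terminal if for all $n\ge1$ every map $\partial\Delta[n]\to X$ sending the last vertex $n$ to $t$ extends to $\Delta[n]$. The limit of $d$ weighted by $p$, written $\lim^pd$, is a vertex $\ell$ of $Q$ together with a map $\lambda\colon\Delta[0]\star^pJ\to Q$ restricting to $\ell$ on $\Delta[0]$ and to $d$ on $J$ that is terminal as a vertex of $Q^p_{/d}$; it is determined up to equivalence in $Q$. The ordinary limit $\lim(e)$ of a diagram $e\colon K\to Q$ is the analogous notion with the unweighted join: a vertex with a cone $\Delta[0]\star K\to Q$ over $e$ terminal in the slice $Q_{/e}$, whose $n$-simplices are maps $\Delta[n]\star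 K\to Q$ restricting to $e$ on $K$. The symbol $\simeq$ denotes equivalence of objects in $Q$. *)

theory Defs
  imports "HOL-Library.FuncSet"
begin

text \<open>A monotone map \<open>\<alpha> : [m] \<rightarrow> [n]\<close> is encoded by its list of values
  \<open>\<alpha> 0 \<le> \<dots> \<le> \<alpha> m\<close>. The list determines \<open>m\<close> but not \<open>n\<close>.\<close>

definition ops :: "nat \<Rightarrow> nat \<Rightarrow> nat list set" where
  "ops m n = {\<alpha>. length \<alpha> = Suc m \<and> sorted \<alpha> \<and> set \<alpha> \<subseteq> {..n}}"

definition op_id :: "nat \<Rightarrow> nat list" where
  "op_id n = [0..<Suc n]"

definition op_comp :: "nat list \<Rightarrow> nat list \<Rightarrow> nat list" where
  "op_comp \<beta> \<alpha> = map (\<lambda>i. \<beta> ! i) \<alpha>"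

definition op_dom :: "nat list \<Rightarrow> nat" where
  "op_dom \<alpha> = length \<alpha> - 1"

text \<open>\<open>act X n \<alpha>\<close> is the map from \<open>cells X n\<close> to \<open>cells X m\<close> induced by
  \<open>\<alpha> : [m] \<rightarrow> [n]\<close>. The sets of cells in different dimensions need not be disjoint.\<close>

record 'a sset =
  cells :: "nat \<Rightarrow> 'a set"
  act :: "nat \<Rightarrow> nat list \<Rightarrow> 'a \<Rightarrow> 'a"

locale simplicial_set =
  fixes X :: "'a sset"
  assumes act_closed:
      "\<lbrakk>\<alpha> \<in> ops m n; x \<in> cells X n\<rbrakk> \<Longrightarrow> act X n \<alpha> x \<in> cells X m"
    and act_id: "x \<in> cells X n \<Longrightarrow> act X n (op_id n) x = x"
    and act_comp:
      "\<lbrakk>\<alpha> \<in> ops k m; \<beta> \<in> ops m n; x \<in> cells X n\<rbrakk>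
        \<Longrightarrow> act X n (op_comp \<beta> \<alpha>) x = act X m \<alpha> (act X n \<beta> x)"

text \<open>Maps are extensional (\<open>undefined\<close> off the cells), so that equality in HOL is equality
  of simplicial maps; this matters because such maps are themselves the cells of slices.\<close>

definition sset_maps :: "'a sset \<Rightarrow> 'b sset \<Rightarrow> (nat \<Rightarrow> 'a \<Rightarrow> 'b) set" where
  "sset_maps X Y = {f. (\<forall>n. f n \<in> cells X n \<rightarrow>\<^sub>E cells Y n) \<and>
     (\<forall>m n. \<forall>\<alpha>\<in>ops m n. \<forall>x\<in>cells X n. f m (act X n \<alpha> x) = act Y n \<alpha> (f n x))}"

definition sset_id :: "'a sset \<Rightarrow> nat \<Rightarrow> 'a \<Rightarrow> 'a" where
  "sset_id X = (\<lambda>n. \<lambda>x\<in>cells X n. x)"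

text \<open>\<open>sset_comp X g f\<close> is \<open>g \<circ> f\<close>, where \<open>X\<close> is the domain of \<open>f\<close>.\<close>

definition sset_comp ::
    "'a sset \<Rightarrow> (nat \<Rightarrow> 'b \<Rightarrow> 'c) \<Rightarrow> (nat \<Rightarrow> 'a \<Rightarrow> 'b) \<Rightarrow> nat \<Rightarrow> 'a \<Rightarrow> 'c" where
  "sset_comp X g f = (\<lambda>n. compose (cells X n) (g n) (f n))"

definition sset_restrict :: "'a sset \<Rightarrow> (nat \<Rightarrow> 'a \<Rightarrow> 'b) \<Rightarrow> nat \<Rightarrow> 'a \<Rightarrow> 'b" where
  "sset_restrict A f = (\<lambda>n. restrict (f n) (cells A n))"

definition std_simplex :: "nat \<Rightarrow> nat list sset" where
  "std_simplex n = \<lparr>cells = (\<lambda>m. ops m n), act = (\<lambda>m \<alpha> \<beta>. op_comp \<beta> \<alpha>)\<rparr>"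

definition std_simplex_map :: "nat list \<Rightarrow> nat \<Rightarrow> nat list \<Rightarrow> nat list" where
  "std_simplex_map \<alpha> = (\<lambda>k. \<lambda>\<beta>\<in>cells (std_simplex (op_dom \<alpha>)) k. op_comp \<alpha> \<beta>)"

definition boundary :: "nat \<Rightarrow> nat list sset" where
  "boundary n = \<lparr>cells = (\<lambda>m. {\<beta> \<in> ops m n. \<not> {..n} \<subseteq> set \<beta>}),
                 act = (\<lambda>m \<alpha> \<beta>. op_comp \<beta> \<alpha>)\<rparr>"

definition horn :: "nat \<Rightarrow> nat \<Rightarrow> nat list sset" where
  "horn n k = \<lparr>cells = (\<lambda>m. {\<beta> \<in> ops m n. \<not> {..n} - {k} \<subseteq> set \<beta>}),
               act = (\<lambda>m \<alpha> \<beta>. op_comp \<beta> \<alpha>)\<rparr>"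

locale quasi_category = simplicial_set Q for Q :: "'q sset" +
  assumes inner_horn_filler:
    "\<lbrakk>0 < k; k < n; f \<in> sset_maps (horn n k) Q\<rbrakk>
      \<Longrightarrow> \<exists>g\<in>sset_maps (std_simplex n) Q. sset_restrict (horn n k) g = f"

definition terminal :: "'a sset \<Rightarrow> 'a \<Rightarrow> bool" where
  "terminal X t \<longleftrightarrow> t \<in> cells X 0 \<and>
     (\<forall>n\<ge>1. \<forall>f\<in>sset_maps (boundary n) X. f 0 [n] = t \<longrightarrow>
        (\<exists>g\<in>sset_maps (std_simplex n) X. sset_restrict (boundary n) g = f))"

text \<open>Two vertices are equivalent if there are edges \<open>f : x \<rightarrow> y\<close> and \<open>g : y \<rightarrow> x\<close>
  with 2-simplices witnessing that \<open>g \<circ> f\<close> and \<open>f \<circ> g\<close> are homotopic to the (degenerate)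
  identity edges.\<close>

definition is_edge :: "'a sset \<Rightarrow> 'a \<Rightarrow> 'a \<Rightarrow> 'a \<Rightarrow> bool" where
  "is_edge Q f x y \<longleftrightarrow> f \<in> cells Q 1 \<and> act Q 1 [0] f = x \<and> act Q 1 [1] f = y"

definition composite_witness :: "'a sset \<Rightarrow> 'a \<Rightarrow> 'a \<Rightarrow> 'a \<Rightarrow> 'a \<Rightarrow> bool" where
  "composite_witness Q \<sigma> f g h \<longleftrightarrow> \<sigma> \<in> cells Q 2 \<and>
     act Q 2 [0,1] \<sigma> = f \<and> act Q 2 [1,2] \<sigma> = g \<and> act Q 2 [0,2] \<sigma> = h"

definition equivalent :: "'a sset \<Rightarrow> 'a \<Rightarrow> 'a \<Rightarrow> bool" where
  "equivalent Q x y \<longleftrightarrow> x \<in> cells Q 0 \<and> y \<in> cells Q 0 \<and>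
     (\<exists>f g \<sigma> \<tau>. is_edge Q f x y \<and> is_edge Q g y x \<and>
        composite_witness Q \<sigma> f g (act Q 0 [0,0] x) \<and>
        composite_witness Q \<tau> g f (act Q 0 [0,0] y))"

text \<open>In \<open>JoinLR i x y\<close> the dimension \<open>i\<close> of \<open>x\<close> is recorded, as \<open>x\<close> may be a cell in
  several dimensions.\<close>

datatype ('a, 'b) join_cell = JoinL 'a | JoinR 'b | JoinLR nat 'a 'b

text \<open>For a cell \<open>JoinLR i x y\<close> of dimension \<open>n\<close>, \<open>[n]\<close> is the ordinal sum of
  \<open>[i]\<close> and \<open>[n - 1 - i]\<close>; an operator into \<open>[n]\<close> is split into its parts over the two
  summands, either of which may be empty.\<close>

fun join_act :: "'a sset \<Rightarrow> 'b sset \<Rightarrow> nat \<Rightarrow> nat list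
    \<Rightarrow> ('a, 'b) join_cell \<Rightarrow> ('a, 'b) join_cell" where
  "join_act X Y n \<alpha> (JoinL x) = JoinL (act X n \<alpha> x)"
| "join_act X Y n \<alpha> (JoinR y) = JoinR (act Y n \<alpha> y)"
| "join_act X Y n \<alpha> (JoinLR i x y) =
     (let \<beta> = filter (\<lambda>k. k \<le> i) \<alpha>;
          \<gamma> = map (\<lambda>k. k - Suc i) (filter (\<lambda>k. i < k) \<alpha>)
      in if \<gamma> = [] then JoinL (act X i \<beta> x)
         else if \<beta> = [] then JoinR (act Y (n - 1 - i) \<gamma> y)
         else JoinLR (op_dom \<beta>) (act X i \<beta> x) (act Y (n - 1 - i) \<gamma> y))"

definition join :: "'a sset \<Rightarrow> 'b sset \<Rightarrow> ('a, 'b) join_cell sset" where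
  "join X Y =
    \<lparr>cells = (\<lambda>n. JoinL ` cells X n \<union> JoinR ` cells Y n \<union>
        {JoinLR i x y | i x y. i < n \<and> x \<in> cells X i \<and> y \<in> cells Y (n - 1 - i)}),
     act = join_act X Y\<rparr>"

definition join_inl :: "'a sset \<Rightarrow> nat \<Rightarrow> 'a \<Rightarrow> ('a, 'b) join_cell" where
  "join_inl X = (\<lambda>n. \<lambda>x\<in>cells X n. JoinL x)"

definition join_inr :: "'b sset \<Rightarrow> nat \<Rightarrow> 'b \<Rightarrow> ('a, 'b) join_cell" where
  "join_inr Y = (\<lambda>n. \<lambda>y\<in>cells Y n. JoinR y)"

text \<open>\<open>join_map X Y h\<close> is the map from \<open>join X Y\<close> to \<open>join X' Y\<close> induced by
  \<open>h : X \<rightarrow> X'\<close>.\<close>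

definition join_map :: "'a sset \<Rightarrow> 'b sset \<Rightarrow> (nat \<Rightarrow> 'a \<Rightarrow> 'c)
    \<Rightarrow> nat \<Rightarrow> ('a, 'b) join_cell \<Rightarrow> ('c, 'b) join_cell" where
  "join_map X Y h = (\<lambda>n. \<lambda>c\<in>cells (join X Y) n.
     case c of JoinL x \<Rightarrow> JoinL (h n x) | JoinR y \<Rightarrow> JoinR y | JoinLR i x y \<Rightarrow> JoinLR i (h i x) y)"

text \<open>The pushout of \<open>f : Z \<rightarrow> X\<close> and \<open>g : Z \<rightarrow> Y\<close> is computed dimensionwise, as the
  quotient of the disjoint union by the equivalence relation generated by identifying
  \<open>f z\<close> with \<open>g z\<close>. The image \<open>r `` S\<close> of the set \<open>S\<close> of values on the representatives
  of a class is the induced value on that class.\<close>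

definition pushout_rel :: "'z sset \<Rightarrow> 'x sset \<Rightarrow> 'y sset \<Rightarrow> (nat \<Rightarrow> 'z \<Rightarrow> 'x)
    \<Rightarrow> (nat \<Rightarrow> 'z \<Rightarrow> 'y) \<Rightarrow> nat \<Rightarrow> ('x + 'y) rel" where
  "pushout_rel Z X Y f g n =
    (let R = {(Inl (f n z), Inr (g n z)) | z. z \<in> cells Z n};
         A = cells X n <+> cells Y n
     in (R \<union> R\<inverse>)\<^sup>* \<inter> A \<times> A)"

definition pushout :: "'z sset \<Rightarrow> 'x sset \<Rightarrow> 'y sset \<Rightarrow> (nat \<Rightarrow> 'z \<Rightarrow> 'x)
    \<Rightarrow> (nat \<Rightarrow> 'z \<Rightarrow> 'y) \<Rightarrow> ('x + 'y) set sset" where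
  "pushout Z X Y f g =
    \<lparr>cells = (\<lambda>n. (cells X n <+> cells Y n) // pushout_rel Z X Y f g n),
     act = (\<lambda>n \<alpha> C. pushout_rel Z X Y f g (op_dom \<alpha>) ``
              (map_sum (act X n \<alpha>) (act Y n \<alpha>) ` C))\<rparr>"

definition pushout_inl :: "'z sset \<Rightarrow> 'x sset \<Rightarrow> 'y sset \<Rightarrow> (nat \<Rightarrow> 'z \<Rightarrow> 'x)
    \<Rightarrow> (nat \<Rightarrow> 'z \<Rightarrow> 'y) \<Rightarrow> nat \<Rightarrow> 'x \<Rightarrow> ('x + 'y) set" where
  "pushout_inl Z X Y f g = (\<lambda>n. \<lambda>x\<in>cells X n. pushout_rel Z X Y f g n `` {Inl x})"

definition pushout_inr :: "'z sset \<Rightarrow> 'x sset \<Rightarrow> 'y sset \<Rightarrow> (nat \<Rightarrow> 'z \<Rightarrow> 'x)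
    \<Rightarrow> (nat \<Rightarrow> 'z \<Rightarrow> 'y) \<Rightarrow> nat \<Rightarrow> 'y \<Rightarrow> ('x + 'y) set" where
  "pushout_inr Z X Y f g = (\<lambda>n. \<lambda>y\<in>cells Y n. pushout_rel Z X Y f g n `` {Inr y})"

text \<open>The weight is a map \<open>p : K \<rightarrow> J\<close>. The weighted join of \<open>I\<close> with \<open>J\<close> is the pushout
  of \<open>join I K\<close> and \<open>J\<close> along the canonical \<open>K \<rightarrow> join I K\<close> and \<open>p\<close>.\<close>

definition wjoin :: "'i sset \<Rightarrow> 'k sset \<Rightarrow> 'j sset \<Rightarrow> (nat \<Rightarrow> 'k \<Rightarrow> 'j)
    \<Rightarrow> (('i, 'k) join_cell + 'j) set sset" where
  "wjoin I K J p = pushout K (join I K) J (join_inr K) p"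

definition wjoin_inl :: "'i sset \<Rightarrow> 'k sset \<Rightarrow> 'j sset \<Rightarrow> (nat \<Rightarrow> 'k \<Rightarrow> 'j)
    \<Rightarrow> nat \<Rightarrow> 'i \<Rightarrow> (('i, 'k) join_cell + 'j) set" where
  "wjoin_inl I K J p =
     sset_comp I (pushout_inl K (join I K) J (join_inr K) p) (join_inl I)"

definition wjoin_inr :: "'i sset \<Rightarrow> 'k sset \<Rightarrow> 'j sset \<Rightarrow> (nat \<Rightarrow> 'k \<Rightarrow> 'j)
    \<Rightarrow> nat \<Rightarrow> 'j \<Rightarrow> (('i, 'k) join_cell + 'j) set" where
  "wjoin_inr I K J p = pushout_inr K (join I K) J (join_inr K) p"

definition wjoin_map :: "'i sset \<Rightarrow> 'l sset \<Rightarrow> 'k sset \<Rightarrow> 'j sset \<Rightarrow> (nat \<Rightarrow> 'k \<Rightarrow> 'j)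
    \<Rightarrow> (nat \<Rightarrow> 'i \<Rightarrow> 'l)
    \<Rightarrow> nat \<Rightarrow> (('i, 'k) join_cell + 'j) set \<Rightarrow> (('l, 'k) join_cell + 'j) set" where
  "wjoin_map I I' K J p h = (\<lambda>n. \<lambda>C\<in>cells (wjoin I K J p) n.
     pushout_rel K (join I' K) J (join_inr K) p n ``
       (map_sum (join_map I K h n) (sset_id J n) ` C))"

definition slice :: "'q sset \<Rightarrow> 'k sset \<Rightarrow> (nat \<Rightarrow> 'k \<Rightarrow> 'q)
    \<Rightarrow> (nat \<Rightarrow> (nat list, 'k) join_cell \<Rightarrow> 'q) sset" where
  "slice Q K e =
    \<lparr>cells = (\<lambda>n. {\<sigma> \<in> sset_maps (join (std_simplex n) K) Q.
                     sset_comp K \<sigma> (join_inr K) = e}),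
     act = (\<lambda>n \<alpha> \<sigma>. sset_comp (join (std_simplex (op_dom \<alpha>)) K) \<sigma>
              (join_map (std_simplex (op_dom \<alpha>)) K (std_simplex_map \<alpha>)))\<rparr>"

definition wslice :: "'q sset \<Rightarrow> 'k sset \<Rightarrow> 'j sset \<Rightarrow> (nat \<Rightarrow> 'k \<Rightarrow> 'j) \<Rightarrow> (nat \<Rightarrow> 'j \<Rightarrow> 'q)
    \<Rightarrow> (nat \<Rightarrow> ((nat list, 'k) join_cell + 'j) set \<Rightarrow> 'q) sset" where
  "wslice Q K J p d =
    \<lparr>cells = (\<lambda>n. {\<sigma> \<in> sset_maps (wjoin (std_simplex n) K J p) Q.
                     sset_comp J \<sigma> (wjoin_inr (std_simplex n) K J p) = d}),
     act = (\<lambda>n \<alpha> \<sigma>. sset_comp (wjoin (std_simplex (op_dom \<alpha>)) K J p) \<sigma>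
              (wjoin_map (std_simplex (op_dom \<alpha>)) (std_simplex n) K J p (std_simplex_map \<alpha>)))\<rparr>"

text \<open>Maps from \<open>std_simplex 0\<close> are identified with their value at the vertex \<open>[0]\<close>.\<close>

definition is_limit :: "'q sset \<Rightarrow> 'k sset \<Rightarrow> (nat \<Rightarrow> 'k \<Rightarrow> 'q)
    \<Rightarrow> 'q \<Rightarrow> (nat \<Rightarrow> (nat list, 'k) join_cell \<Rightarrow> 'q) \<Rightarrow> bool" where
  "is_limit Q K e l c \<longleftrightarrow> l \<in> cells Q 0 \<and>
     c \<in> sset_maps (join (std_simplex 0) K) Q \<and>
     sset_comp (std_simplex 0) c (join_inl (std_simplex 0)) 0 [0] = l \<and>
     sset_comp K c (join_inr K) = e \<and>
     terminal (slice Q K e) c"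

definition is_weighted_limit :: "'q sset \<Rightarrow> 'k sset \<Rightarrow> 'j sset \<Rightarrow> (nat \<Rightarrow> 'k \<Rightarrow> 'j)
    \<Rightarrow> (nat \<Rightarrow> 'j \<Rightarrow> 'q) \<Rightarrow> 'q
    \<Rightarrow> (nat \<Rightarrow> ((nat list, 'k) join_cell + 'j) set \<Rightarrow> 'q) \<Rightarrow> bool" where
  "is_weighted_limit Q K J p d l c \<longleftrightarrow> l \<in> cells Q 0 \<and>
     c \<in> sset_maps (wjoin (std_simplex 0) K J p) Q \<and>
     sset_comp (std_simplex 0) c (wjoin_inl (std_simplex 0) K J p) 0 [0] = l \<and>
     sset_comp J c (wjoin_inr (std_simplex 0) K J p) = d \<and>
     terminal (wslice Q K J p d) c"

end

theory Submission
  imports Defs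
begin

text \<open>By the universal property of the pushout, a map from the weighted join of \<open>\<Delta>[n]\<close> with \<open>J\<close>
  to \<open>Q\<close> restricting to \<open>d\<close> on \<open>J\<close> is the same as a map from the ordinary join of \<open>\<Delta>[n]\<close> with
  \<open>K\<close> to \<open>Q\<close> restricting to \<open>d \<circ> p\<close> on \<open>K\<close>. These bijections commute with the simplicial
  operators, so the weighted slice over \<open>d\<close> is isomorphic to the slice over \<open>d \<circ> p\<close>, over \<open>Q\<close>,
  and the two have the same terminal vertices. Uniqueness of limits reduces to the
  equivalence of any two terminal vertices, which the projection to \<open>Q\<close> preserves.\<close>

section \<open>Simplicial operators as lists of values\<close>

lemma op_comp_ops: "\<alpha> \<in> ops k m \<Longrightarrow> \<beta> \<in> ops m n \<Longrightarrow> op_comp \<beta> \<alpha> \<in> ops k n"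
  by (force simp: ops_def op_comp_def sorted_iff_nth_mono subset_iff less_Suc_eq_le)

lemma op_id_ops: "op_id n \<in> ops n n"
  by (auto simp: ops_def op_id_def simp del: upt_Suc)

lemma op_comp_id_left: "\<alpha> \<in> ops m n \<Longrightarrow> op_comp (op_id n) \<alpha> = \<alpha>"
  by (auto simp: ops_def op_comp_def op_id_def subset_iff less_Suc_eq_le simp del: upt_Suc
      intro: map_idI)

lemma op_comp_id_right: "\<alpha> \<in> ops m n \<Longrightarrow> op_comp \<alpha> (op_id m) = \<alpha>"
  by (auto simp: ops_def op_comp_def op_id_def simp del: upt_Suc intro: nth_equalityI)

lemma op_comp_assoc:
  "\<alpha> \<in> ops k m \<Longrightarrow> \<beta> \<in> ops m n \<Longrightarrow> op_comp \<gamma> (op_comp \<beta> \<alpha>) = op_comp (op_comp \<gamma> \<beta>) \<alpha>"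
  by (auto simp: ops_def op_comp_def subset_iff less_Suc_eq_le)

lemma op_dom_ops: "\<alpha> \<in> ops m n \<Longrightarrow> op_dom \<alpha> = m"
  by (simp add: ops_def op_dom_def)

lemma set_op_comp_subset: "\<alpha> \<in> ops k m \<Longrightarrow> \<beta> \<in> ops m n \<Longrightarrow> set (op_comp \<beta> \<alpha>) \<subseteq> set \<beta>"
  by (force simp: ops_def op_comp_def subset_iff)

text \<open>The list of \<open>m + 1\<close> zeros is the only operator from \<open>[m]\<close> to
  \<open>[0]\<close>; acting by it gives the totally degenerate \<open>m\<close>-cell on a vertex.
  Constant operators are reduced to that one.\<close>

lemma ops_constant:
  assumes "\<alpha> \<in> ops m n" "set \<alpha> \<subseteq> {i}"
  shows "\<alpha> = op_comp [i] (replicate (Suc m) 0)"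
proof -
  have "\<alpha> = replicate (Suc m) i"
    using assms by (intro replicate_eqI) (auto simp: ops_def)
  thus ?thesis by (simp add: op_comp_def)
qed

lemma replicate_ops: "replicate (Suc m) 0 \<in> ops m n"
  by (auto simp: ops_def sorted_replicate simp del: replicate_Suc)

lemma op_comp_replicate:
  assumes "\<alpha> \<in> ops k m"
  shows "op_comp (replicate (Suc m) 0) \<alpha> = replicate (Suc k) 0"
  using assms
  by (intro replicate_eqI)
    (auto simp: ops_def op_comp_def subset_iff less_Suc_eq_le simp del: replicate_Suc)

text \<open>Covers the three branches of \<open>join_act\<close>. The two filters partition the
  \<open>m + 1\<close> entries of \<alpha>, so the lengths add up to \<open>m + 1\<close> and, if
  both parts are nonempty, the dimensions add up to \<open>m - 1\<close>. The empty list encodes no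
  operator, which forces the case distinction.\<close>

lemma ops_split:
  assumes \<alpha>: "\<alpha> \<in> ops m n" and i: "i < n"
  defines "\<beta> \<equiv> filter (\<lambda>k. k \<le> i) \<alpha>" and "\<gamma> \<equiv> map (\<lambda>k. k - Suc i) (filter (\<lambda>k. i < k) \<alpha>)"
  shows "\<gamma> = [] \<Longrightarrow> \<beta> \<in> ops m i"
    and "\<beta> = [] \<Longrightarrow> \<gamma> \<in> ops m (n - 1 - i)"
    and "\<gamma> \<noteq> [] \<Longrightarrow> \<beta> \<noteq> [] \<Longrightarrow>
      op_dom \<beta> < m \<and> \<beta> \<in> ops (op_dom \<beta>) i \<and> \<gamma> \<in> ops (m - 1 - op_dom \<beta>) (n - 1 - i)"
proof -
  have len: "length \<beta> + length \<gamma> = Suc m"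
    using \<alpha> sum_length_filter_compl[of "\<lambda>k. k \<le> i" \<alpha>] by (simp add: \<beta>_def \<gamma>_def ops_def not_le)
  have "sorted \<beta>" "set \<beta> \<subseteq> {..i}"
    using \<alpha> by (auto simp: \<beta>_def ops_def sorted_filter[where f = id, simplified])
  moreover have "sorted (filter (\<lambda>k. i < k) \<alpha>)"
    using \<alpha> by (auto simp: ops_def sorted_filter[where f = id, simplified])
  hence "sorted \<gamma>"
    unfolding \<gamma>_def by (auto simp: sorted_iff_nth_mono intro: diff_le_mono)
  moreover have "set \<gamma> \<subseteq> {..n - 1 - i}"
    using \<alpha> by (auto simp: \<gamma>_def ops_def)
  ultimately show "\<gamma> = [] \<Longrightarrow> \<beta> \<in> ops m i"
    and "\<beta> = [] \<Longrightarrow> \<gamma> \<in> ops m (n - 1 - i)"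
    and "\<gamma> \<noteq> [] \<Longrightarrow> \<beta> \<noteq> [] \<Longrightarrow>
      op_dom \<beta> < m \<and> \<beta> \<in> ops (op_dom \<beta>) i \<and> \<gamma> \<in> ops (m - 1 - op_dom \<beta>) (n - 1 - i)"
    using len by (auto simp: ops_def op_dom_def length_greater_0_conv[symmetric]
        simp del: length_greater_0_conv)
qed

text \<open>Functoriality of joins and pushouts is never needed: to compose simplicial maps it is enough
  that the operators preserve cells.\<close>

definition act_stable :: "'a sset \<Rightarrow> bool" where
  "act_stable X \<longleftrightarrow> (\<forall>m n. \<forall>\<alpha>\<in>ops m n. \<forall>x\<in>cells X n. act X n \<alpha> x \<in> cells X m)"

lemma act_stableD: "act_stable X \<Longrightarrow> \<alpha> \<in> ops m n \<Longrightarrow> x \<in> cells X n \<Longrightarrow> act X n \<alpha> x \<in> cells X m"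
  by (auto simp: act_stable_def)

lemma simplicial_set_act_stable: "simplicial_set X \<Longrightarrow> act_stable X"
  by (auto simp: act_stable_def simplicial_set.act_closed)

section \<open>Maps of simplicial sets\<close>

lemma sset_mapsI:
  assumes "\<And>n x. x \<in> cells X n \<Longrightarrow> f n x \<in> cells Y n"
    and "\<And>n x. x \<notin> cells X n \<Longrightarrow> f n x = undefined"
    and "\<And>m n \<alpha> x. \<alpha> \<in> ops m n \<Longrightarrow> x \<in> cells X n \<Longrightarrow> f m (act X n \<alpha> x) = act Y n \<alpha> (f n x)"
  shows "f \<in> sset_maps X Y"
  using assms by (auto simp: sset_maps_def)

lemma sset_maps_cell: "f \<in> sset_maps X Y \<Longrightarrow> x \<in> cells X n \<Longrightarrow> f n x \<in> cells Y n"
  by (auto simp: sset_maps_def)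

lemma sset_maps_undefined: "f \<in> sset_maps X Y \<Longrightarrow> x \<notin> cells X n \<Longrightarrow> f n x = undefined"
  by (auto simp: sset_maps_def)

lemma sset_maps_act:
  "f \<in> sset_maps X Y \<Longrightarrow> \<alpha> \<in> ops m n \<Longrightarrow> x \<in> cells X n \<Longrightarrow> f m (act X n \<alpha> x) = act Y n \<alpha> (f n x)"
  by (auto simp: sset_maps_def)

lemma sset_maps_eqI:
  assumes "f \<in> sset_maps X Y" "g \<in> sset_maps X Z" "\<And>n x. x \<in> cells X n \<Longrightarrow> f n x = g n x"
  shows "f = g"
  using assms by (intro ext) (metis sset_maps_undefined)

lemma sset_comp_apply: "x \<in> cells X n \<Longrightarrow> sset_comp X g f n x = g n (f n x)"
  by (simp add: sset_comp_def compose_def)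

lemma sset_comp_undefined: "x \<notin> cells X n \<Longrightarrow> sset_comp X g f n x = undefined"
  by (simp add: sset_comp_def compose_def)

lemma sset_comp_maps:
  assumes "act_stable X" "f \<in> sset_maps X Y" "g \<in> sset_maps Y Z"
  shows "sset_comp X g f \<in> sset_maps X Z"
  using assms
  by (intro sset_mapsI)
    (auto simp: sset_comp_apply sset_comp_undefined act_stableD sset_maps_act sset_maps_cell)

lemma sset_restrict_apply: "x \<in> cells A n \<Longrightarrow> sset_restrict A f n x = f n x"
  by (simp add: sset_restrict_def)

lemma sset_restrict_comp:
  assumes "\<And>n. cells A n \<subseteq> cells X n"
  shows "sset_restrict A (sset_comp X g f) = sset_comp A g (sset_restrict A f)"
  using assms by (auto simp: sset_restrict_def sset_comp_def compose_def restrict_def fun_eq_iff)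

section \<open>Standard simplices and their boundaries\<close>

lemma std_simplex_simplicial: "simplicial_set (std_simplex n)"
  by unfold_locales
    (auto simp: std_simplex_def op_comp_ops op_comp_id_right op_comp_assoc)

text \<open>Precomposition can only shrink the set of values, so a missed vertex stays
  missed.\<close>

lemma boundary_act_stable: "act_stable (boundary n)"
proof -
  have "\<not> {..n} \<subseteq> set (op_comp \<beta> \<alpha>)"
    if "\<alpha> \<in> ops k m" "\<beta> \<in> ops m n" "\<not> {..n} \<subseteq> set \<beta>" for k m \<alpha> \<beta>
    using set_op_comp_subset[OF that(1,2)] that(3) by blast
  thus ?thesis by (simp add: act_stable_def boundary_def op_comp_ops)
qed

lemma std_simplex_map_maps:
  assumes "\<alpha> \<in> ops m n"
  shows "std_simplex_map \<alpha> \<in> sset_maps (std_simplex m) (std_simplex n)"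
  using assms
  by (intro sset_mapsI)
    (auto simp: std_simplex_map_def std_simplex_def op_dom_ops op_comp_ops op_comp_assoc)

subsection \<open>Terminal vertices\<close>

text \<open>The dimensionwise inverse is automatically simplicial: take naturality of
  \<open>f\<close> at \<open>g n y\<close> and apply \<open>g\<close>.\<close>

lemma sset_iso_inverse:
  assumes X: "act_stable X" and f: "f \<in> sset_maps X Y"
    and bij: "\<And>n. bij_betw (f n) (cells X n) (cells Y n)"
  obtains g where "g \<in> sset_maps Y X"
    and "\<And>n x. x \<in> cells X n \<Longrightarrow> g n (f n x) = x"
    and "\<And>n y. y \<in> cells Y n \<Longrightarrow> f n (g n y) = y"
proof -
  define g where "g n = restrict (inv_into (cells X n) (f n)) (cells Y n)" for n
  have gf: "g n (f n x) = x" if "x \<in> cells X n" for n x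
    using that bij_betw_inv_into_left[OF bij] sset_maps_cell[OF f] by (simp add: g_def)
  have fg: "f n (g n y) = y" if "y \<in> cells Y n" for n y
    using that bij_betw_inv_into_right[OF bij] by (simp add: g_def)
  have gcell: "g n y \<in> cells X n" if "y \<in> cells Y n" for n y
    using that bij[of n] by (simp add: g_def bij_betw_def inv_into_into)
  have "g \<in> sset_maps Y X"
  proof (rule sset_mapsI)
    fix m n \<alpha> y assume \<alpha>: "\<alpha> \<in> ops m n" and y: "y \<in> cells Y n"
    have "act Y n \<alpha> y = f m (act X n \<alpha> (g n y))"
      using sset_maps_act[OF f \<alpha> gcell[OF y]] fg[OF y] by simp
    thus "g m (act Y n \<alpha> y) = act X n \<alpha> (g n y)"
      using gf act_stableD[OF X \<alpha> gcell[OF y]] by simp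
  qed (auto simp: gcell, simp add: g_def)
  thus ?thesis using gf fg that by blast
qed

text \<open>A boundary in \<open>Y\<close> with last vertex \<open>f 0 t\<close> is carried by
  \<open>g\<close> to one in \<open>X\<close> with last vertex \<open>t\<close>, filled there, and
  the filler is carried back by \<open>f\<close>.\<close>

lemma terminal_iso:
  assumes f: "f \<in> sset_maps X Y" and g: "g \<in> sset_maps Y X"
    and gf: "\<And>n x. x \<in> cells X n \<Longrightarrow> g n (f n x) = x"
    and fg: "\<And>n y. y \<in> cells Y n \<Longrightarrow> f n (g n y) = y"
    and t: "terminal X t"
  shows "terminal Y (f 0 t)"
  unfolding terminal_def
proof (intro conjI allI ballI impI)
  have t0: "t \<in> cells X 0" using t by (simp add: terminal_def)
  thus "f 0 t \<in> cells Y 0" by (rule sset_maps_cell[OF f])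
  fix n :: nat and b assume n: "1 \<le> n" and b: "b \<in> sset_maps (boundary n) Y" and bt: "b 0 [n] = f 0 t"
  \<comment> \<open>From dimension 1 on the last vertex lies in the boundary, since it misses
    0.\<close>
  have vertex: "[n] \<in> cells (boundary n) 0"
    using n by (auto simp: boundary_def ops_def)
  have "sset_comp (boundary n) g b \<in> sset_maps (boundary n) X"
    by (rule sset_comp_maps[OF boundary_act_stable b g])
  moreover have "sset_comp (boundary n) g b 0 [n] = t"
    using gf[OF t0] bt vertex by (simp add: sset_comp_apply)
  ultimately obtain c where c: "c \<in> sset_maps (std_simplex n) X"
    and cr: "sset_restrict (boundary n) c = sset_comp (boundary n) g b"
    using t n by (auto simp: terminal_def)
  have "sset_restrict (boundary n) (sset_comp (std_simplex n) f c)
      = sset_comp (boundary n) f (sset_comp (boundary n) g b)"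
    unfolding cr[symmetric] by (rule sset_restrict_comp) (auto simp: boundary_def std_simplex_def)
  also have "\<dots> = b"
  proof (rule sset_maps_eqI)
    show "sset_comp (boundary n) f (sset_comp (boundary n) g b) \<in> sset_maps (boundary n) Y"
      by (rule sset_comp_maps[OF boundary_act_stable sset_comp_maps[OF boundary_act_stable b g] f])
  qed (auto simp: sset_comp_apply fg sset_maps_cell[OF b] intro: b)
  finally show "\<exists>h\<in>sset_maps (std_simplex n) Y. sset_restrict (boundary n) h = b"
    using sset_comp_maps[OF simplicial_set_act_stable[OF std_simplex_simplicial] c f] by blast
qed

section \<open>Equivalence of terminal vertices\<close>

context simplicial_set
begin

lemma act_act: "\<alpha> \<in> ops k m \<Longrightarrow> \<beta> \<in> ops m n \<Longrightarrow> x \<in> cells X n \<Longrightarrow>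
    act X m \<alpha> (act X n \<beta> x) = act X n (op_comp \<beta> \<alpha>) x"
  by (simp add: act_comp)

text \<open>The operator factors through the vertex \<open>[i]\<close>, so its effect depends on
  that vertex alone. This lets degenerate cells of different edges be compared in
  \<open>triangle_into_terminal\<close>.\<close>

lemma act_constant:
  assumes "\<alpha> \<in> ops m n" "set \<alpha> \<subseteq> {i}" "x \<in> cells X n"
  shows "act X n \<alpha> x = act X 0 (replicate (Suc m) 0) (act X n [i] x)"
proof -
  have "[i] \<in> ops 0 n"
    using assms(1,2) by (cases \<alpha>) (auto simp: ops_def)
  thus ?thesis
    using ops_constant[OF assms(1,2)] act_comp[OF replicate_ops _ assms(3), of "[i]" 0 m] by simp
qed

text \<open>Terminality for \<open>n = 1\<close>: the boundary of the 1-simplex is two points, sent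
  to \<open>s\<close> and \<open>t\<close>, and the extension evaluated at the nondegenerate edge is
  the required edge.\<close>

lemma edge_into_terminal:
  assumes t: "terminal X t" and s: "s \<in> cells X 0"
  shows "\<exists>e. is_edge X e s t"
proof -
  have t0: "t \<in> cells X 0" using t by (simp add: terminal_def)
  \<comment> \<open>A cell of this boundary is constantly 0 or constantly 1; it goes to the
    degenerate cell on \<open>s\<close> or on \<open>t\<close> accordingly.\<close>
  define b where "b m = (\<lambda>\<beta>\<in>cells (boundary 1) m.
    act X 0 (replicate (Suc m) 0) (if 0 \<in> set \<beta> then s else t))" for m
  have "b \<in> sset_maps (boundary 1) X"
  proof (rule sset_mapsI)
    fix n \<beta> assume "\<beta> \<in> cells (boundary 1) n"
    thus "b n \<beta> \<in> cells X n"
      using s t0 replicate_ops by (auto simp: b_def intro!: act_closed simp del: replicate_Suc)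
  next
    fix m n \<alpha> \<beta> assume \<alpha>: "\<alpha> \<in> ops m n" and \<beta>: "\<beta> \<in> cells (boundary 1) n"
    have \<beta>o: "\<beta> \<in> ops n 1" using \<beta> by (simp add: boundary_def)
    have sub: "set (op_comp \<beta> \<alpha>) \<subseteq> set \<beta>" by (rule set_op_comp_subset[OF \<alpha> \<beta>o])
    have ne: "set (op_comp \<beta> \<alpha>) \<noteq> {}" using \<alpha> by (auto simp: op_comp_def ops_def)
    \<comment> \<open>The values of \<beta> form a singleton, and those of the composite are a
      nonempty subset of it, so the test for 0 has the same outcome for both.\<close>
    have "\<not> {0,1} \<subseteq> set \<beta>" "set \<beta> \<subseteq> {0,1}"
      using \<beta> by (auto simp: boundary_def ops_def le_Suc_eq subset_iff)
    moreover obtain i where "i \<in> set (op_comp \<beta> \<alpha>)" using ne by (meson all_not_in_conv)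
    ultimately have "0 \<in> set (op_comp \<beta> \<alpha>) \<longleftrightarrow> 0 \<in> set \<beta>"
      using sub by auto
    thus "b m (act (boundary 1) n \<alpha> \<beta>) = act X n \<alpha> (b n \<beta>)"
      using act_stableD[OF boundary_act_stable \<alpha> \<beta>] \<beta> s t0
      by (simp add: b_def act_act[OF \<alpha> replicate_ops] op_comp_replicate[OF \<alpha>] del: replicate_Suc)
        (simp add: boundary_def)
  qed (simp add: b_def)
  moreover have "[1] \<in> cells (boundary 1) 0" "[0] \<in> cells (boundary 1) 0"
    by (auto simp: boundary_def ops_def)
  hence b: "b 0 [1] = t" "b 0 [0] = s"
    using act_id[OF s] act_id[OF t0] by (simp_all add: b_def op_id_def)
  ultimately obtain g where g: "g \<in> sset_maps (std_simplex 1) X"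
    and gb: "sset_restrict (boundary 1) g = b"
    using t by (auto simp: terminal_def)
  \<comment> \<open>\<open>[0,1]\<close> is the identity operator of \<open>[1]\<close>, so its
    faces are the vertices \<open>[i]\<close>, where \<open>g\<close> agrees with
    \<open>b\<close>.\<close>
  have gi: "act X 1 [i] (g 1 [0,1]) = b 0 [i]" if "i \<le> 1" for i
  proof -
    have "[i] \<in> ops 0 1" "[0,1] \<in> cells (std_simplex 1) 1" "[i] \<in> cells (boundary 1) 0"
      using that by (auto simp: std_simplex_def ops_def boundary_def subset_iff)
    moreover have "op_comp [0,1] [i] = [i]"
      using that by (cases i) (auto simp: op_comp_def)
    ultimately show ?thesis
      using sset_maps_act[OF g, of "[i]" 0 1 "[0,1]"] gb
      by (metis (no_types, lifting) select_convs(2) sset_restrict_apply std_simplex_def)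
  qed
  have "g 1 [0,1] \<in> cells X 1"
    by (rule sset_maps_cell[OF g]) (auto simp: std_simplex_def ops_def)
  thus ?thesis
    using gi[of 0] gi[of 1] b by (auto simp: is_edge_def)
qed

text \<open>Terminality for \<open>n = 2\<close>: put \<open>f\<close> on the edge 01,
  \<open>g\<close> on 12 and the degenerate edge at \<open>s\<close> on 02. The last vertex of this
  boundary is \<open>s\<close>, so it has a filler.\<close>

lemma triangle_into_terminal:
  assumes s: "terminal X s" and f: "is_edge X f s t" and g: "is_edge X g t s"
  shows "\<exists>\<sigma>. composite_witness X \<sigma> f g (act X 0 [0,0] s)"
proof -
  have s0: "s \<in> cells X 0" using s by (simp add: terminal_def)
  have f1: "f \<in> cells X 1" "act X 1 [0] f = s" "act X 1 [1] f = t"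
    and g1: "g \<in> cells X 1" "act X 1 [0] g = t" "act X 1 [1] g = s"
    using f g by (auto simp: is_edge_def)
  \<comment> \<open>On the edge missing 1 the map is the degenerate edge at \<open>s\<close>, so it does not depend on the operator.\<close>
  define bd where "bd m \<beta> = (if 2 \<notin> set \<beta> then act X 1 \<beta> f
    else if 0 \<notin> set \<beta> then act X 1 (map (\<lambda>i. i - 1) \<beta>) g
    else act X 0 (replicate (Suc m) 0) s)" for m and \<beta> :: "nat list"
  define b where "b m = restrict (bd m) (cells (boundary 2) m)" for m
  have low: "\<beta> \<in> ops m 1" if "\<beta> \<in> ops m 2" "2 \<notin> set \<beta>" for m \<beta>
    using that by (force simp: ops_def le_Suc_eq numeral_2_eq_2)
  \<comment> \<open>Truncated subtraction sends 0 and 1 to 0, and 2 to 1. On cells missing 0 it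
    inverts the inclusion of the edge 12.\<close>
  have high: "map (\<lambda>i. i - 1) \<beta> \<in> ops m 1" if "\<beta> \<in> ops m 2" for m \<beta>
    using that by (auto simp: ops_def sorted_iff_nth_mono intro!: diff_le_mono)
  have "b \<in> sset_maps (boundary 2) X"
  proof (rule sset_mapsI)
    fix n \<beta> assume \<beta>: "\<beta> \<in> cells (boundary 2) n"
    hence "\<beta> \<in> ops n 2" by (simp add: boundary_def)
    thus "b n \<beta> \<in> cells X n"
      using \<beta> s0 f1 g1 act_closed[OF low] act_closed[OF high] act_closed[OF replicate_ops s0]
      by (simp add: b_def bd_def)
  next
    fix m n \<alpha> \<beta> assume \<alpha>: "\<alpha> \<in> ops m n" and \<beta>: "\<beta> \<in> cells (boundary 2) n"
    define \<gamma> where "\<gamma> = op_comp \<beta> \<alpha>"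
    have \<beta>o: "\<beta> \<in> ops n 2" and miss: "\<not> {..2} \<subseteq> set \<beta>" using \<beta> by (auto simp: boundary_def)
    have \<gamma>o: "\<gamma> \<in> ops m 2" unfolding \<gamma>_def by (rule op_comp_ops[OF \<alpha> \<beta>o])
    have sub: "set \<gamma> \<subseteq> set \<beta>" unfolding \<gamma>_def by (rule set_op_comp_subset[OF \<alpha> \<beta>o])
    have \<beta>3: "set \<beta> \<subseteq> {0,1,2}" using \<beta>o by (auto simp: ops_def)
    have shift: "op_comp (map (\<lambda>i. i - 1) \<beta>) \<alpha> = map (\<lambda>i. i - 1) \<gamma>"
      using \<alpha> \<beta>o by (auto simp: \<gamma>_def op_comp_def ops_def subset_iff less_Suc_eq_le)
    have const: "act X 1 \<delta> e = act X 0 (replicate (Suc m) 0) (act X 1 [i] e)"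
      if "\<delta> \<in> ops m 1" "set \<delta> \<subseteq> {i}" "e \<in> cells X 1" for \<delta> e i
      using act_constant that by blast
    \<comment> \<open>Passing to \<gamma> may lose the value 0 or 2 and so move the cell to another
      branch of \<open>bd\<close>. In that event \<gamma> is constant, and both branches give the
      degenerate cell on the common vertex.\<close>
    have "bd m \<gamma> = act X n \<alpha> (bd n \<beta>)"
    proof -
      consider "2 \<notin> set \<beta>" | "2 \<in> set \<beta>" "0 \<notin> set \<beta>" | "2 \<in> set \<beta>" "0 \<in> set \<beta>" by blast
      thus ?thesis
      proof cases
        case 1
        hence "2 \<notin> set \<gamma>" using sub by blast
        thus ?thesis
          using 1 act_act[OF \<alpha> low[OF \<beta>o 1] f1(1)] by (simp add: bd_def \<gamma>_def)
      next
        case 2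
        have "act X n \<alpha> (bd n \<beta>) = act X 1 (map (\<lambda>i. i - 1) \<gamma>) g"
          using 2 act_act[OF \<alpha> high[OF \<beta>o] g1(1)] shift by (simp add: bd_def)
        moreover have "act X 1 (map (\<lambda>i. i - 1) \<gamma>) g = act X 1 \<gamma> f" if "2 \<notin> set \<gamma>"
        proof -
          have \<gamma>1: "set \<gamma> \<subseteq> {1}" using sub \<beta>3 2 that by auto
          hence "set (map (\<lambda>i. i - 1) \<gamma>) \<subseteq> {0}" by auto
          thus ?thesis
            using const[OF high[OF \<gamma>o] _ g1(1)] const[OF low[OF \<gamma>o that] \<gamma>1 f1(1)] f1 g1 by simp
        qed
        moreover have "0 \<notin> set \<gamma>" using sub 2 by blast
        ultimately show ?thesis by (auto simp: bd_def)
      next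
        case 3
        have "{..2::nat} = {0,1,2}" by auto
        with miss have "\<not> {0,1,2} \<subseteq> set \<beta>" by metis
        hence 1: "1 \<notin> set \<beta>" using 3 by blast
        have "act X n \<alpha> (bd n \<beta>) = act X 0 (replicate (Suc m) 0) s"
          using 3 act_act[OF \<alpha> replicate_ops s0] op_comp_replicate[OF \<alpha>]
          by (simp add: bd_def del: replicate_Suc)
        moreover have "act X 1 \<gamma> f = act X 0 (replicate (Suc m) 0) s" if "2 \<notin> set \<gamma>"
        proof -
          have "set \<gamma> \<subseteq> {0}" using sub \<beta>3 1 that by auto
          thus ?thesis using const[OF low[OF \<gamma>o that] _ f1(1)] f1 by simp
        qed
        moreover have "act X 1 (map (\<lambda>i. i - 1) \<gamma>) g = act X 0 (replicate (Suc m) 0) s"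
          if "0 \<notin> set \<gamma>"
        proof -
          have "set \<gamma> \<subseteq> {2}" using sub \<beta>3 1 that by auto
          hence "set (map (\<lambda>i. i - 1) \<gamma>) \<subseteq> {1}" by auto
          thus ?thesis using const[OF high[OF \<gamma>o] _ g1(1)] g1 by simp
        qed
        ultimately show ?thesis by (simp add: bd_def)
      qed
    qed
    thus "b m (act (boundary 2) n \<alpha> \<beta>) = act X n \<alpha> (b n \<beta>)"
      using act_stableD[OF boundary_act_stable \<alpha> \<beta>] \<beta>
      by (simp add: b_def \<gamma>_def) (simp add: boundary_def)
  qed (simp add: b_def)
  moreover have faces: "[2] \<in> cells (boundary 2) 0" "[0,1] \<in> cells (boundary 2) 1"
    "[1,2] \<in> cells (boundary 2) 1" "[0,2] \<in> cells (boundary 2) 1"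
    using atMost_iff[of 0 "2::nat"] atMost_iff[of 1 "2::nat"]
    by (auto simp: boundary_def ops_def simp del: atMost_iff)
  have "b 0 [2] = s" "b 1 [0,1] = f" "b 1 [1,2] = g" "b 1 [0,2] = act X 0 [0,0] s"
    using faces act_id[OF f1(1)] act_id[OF g1(1)] g1 by (simp_all add: b_def bd_def op_id_def)
  ultimately obtain h where h: "h \<in> sset_maps (std_simplex 2) X"
    and hb: "sset_restrict (boundary 2) h = b"
    using s unfolding terminal_def by (metis one_le_numeral)
  \<comment> \<open>The filler is read off at the fundamental cell \<open>op_id 2\<close>, whose
    face along \<beta> is \<beta> itself.\<close>
  have id2: "op_id 2 \<in> cells (std_simplex 2) 2" using op_id_ops by (simp add: std_simplex_def)
  have "act X 2 \<beta> (h 2 (op_id 2)) = b 1 \<beta>" if "\<beta> \<in> cells (boundary 2) 1" for \<beta>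
  proof -
    have \<beta>: "\<beta> \<in> ops 1 2" using that by (simp add: boundary_def)
    have "act (std_simplex 2) 2 \<beta> (op_id 2) = \<beta>"
      using op_comp_id_left[OF \<beta>] by (simp add: std_simplex_def)
    thus ?thesis
      using sset_maps_act[OF h \<beta> id2] sset_restrict_apply[OF that, of h] hb by simp
  qed
  with faces \<open>b 1 [0,1] = f\<close> \<open>b 1 [1,2] = g\<close> \<open>b 1 [0,2] = act X 0 [0,0] s\<close>
  have "composite_witness X (h 2 (op_id 2)) f g (act X 0 [0,0] s)"
    using sset_maps_cell[OF h id2] by (simp add: composite_witness_def)
  thus ?thesis by blast
qed

text \<open>Terminality of each vertex supplies the edge into it from the other one and the triangle
  whose last vertex it is.\<close>

lemma terminal_equivalent:
  assumes s: "terminal X s" and t: "terminal X t"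
  shows "equivalent X s t"
proof -
  have s0: "s \<in> cells X 0" and t0: "t \<in> cells X 0" using s t by (auto simp: terminal_def)
  obtain f g where "is_edge X f s t" "is_edge X g t s"
    using edge_into_terminal s t s0 t0 by meson
  thus ?thesis
    using triangle_into_terminal s t s0 t0 by (meson equivalent_def)
qed

end

text \<open>The data of \<open>equivalent\<close> are cells and equations between their faces and
  degeneracies, all preserved by simplicial maps.\<close>

lemma equivalent_map:
  assumes X: "simplicial_set X" and f: "f \<in> sset_maps X Y" and eq: "equivalent X s t"
  shows "equivalent Y (f 0 s) (f 0 t)"
proof -
  have ops: "[i] \<in> ops 0 1" if "i \<le> 1" for i using that by (simp add: ops_def)
  have edge: "is_edge Y (f 1 e) (f 0 x) (f 0 y)" if "is_edge X e x y" for e x y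
    using that sset_maps_act[OF f ops, of _ e] sset_maps_cell[OF f, of e 1]
    by (auto simp: is_edge_def)
  have ops2: "[i,j] \<in> ops 1 2" if "i \<le> j" "j \<le> 2" for i j using that by (simp add: ops_def)
  have tri: "composite_witness Y (f 2 \<sigma>) (f 1 u) (f 1 v) (act Y 0 [0,0] (f 0 x))"
    if "composite_witness X \<sigma> u v (act X 0 [0,0] x)" "x \<in> cells X 0" for \<sigma> u v x
  proof -
    have "act Y 0 [0,0] (f 0 x) = f 1 (act X 0 [0,0] x)"
      using sset_maps_act[OF f _ that(2), of "[0,0]" 1] by (simp add: ops_def)
    thus ?thesis
      using that(1) sset_maps_act[OF f ops2, of _ _ \<sigma>, symmetric] sset_maps_cell[OF f, of \<sigma> 2]
      by (auto simp: composite_witness_def)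
  qed
  show ?thesis
    using eq edge tri sset_maps_cell[OF f, of _ 0] unfolding equivalent_def by blast
qed

subsection \<open>Joins and slices\<close>

lemma join_cells_cases:
  assumes "c \<in> cells (join X Y) n"
  obtains (L) x where "c = JoinL x" "x \<in> cells X n"
  | (R) y where "c = JoinR y" "y \<in> cells Y n"
  | (LR) i x y where "c = JoinLR i x y" "i < n" "x \<in> cells X i" "y \<in> cells Y (n - 1 - i)"
  using assms by (auto simp: join_def)

lemma join_cells_simps:
  "JoinL x \<in> cells (join X Y) n \<longleftrightarrow> x \<in> cells X n"
  "JoinR y \<in> cells (join X Y) n \<longleftrightarrow> y \<in> cells Y n"
  "JoinLR i x y \<in> cells (join X Y) n \<longleftrightarrow> i < n \<and> x \<in> cells X i \<and> y \<in> cells Y (n - 1 - i)"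
  by (auto simp: join_def)

lemma act_join: "act (join X Y) = join_act X Y"
  by (simp add: join_def)

lemma join_act_stable:
  assumes "act_stable X" "act_stable Y"
  shows "act_stable (join X Y)"
  unfolding act_stable_def
proof (intro allI ballI)
  fix m n \<alpha> c assume \<alpha>: "\<alpha> \<in> ops m n" and "c \<in> cells (join X Y) n"
  from this(2) show "act (join X Y) n \<alpha> c \<in> cells (join X Y) m"
  proof (cases rule: join_cells_cases)
    case (LR i x y)
    thus ?thesis
      using ops_split[OF \<alpha> LR(2)] assms[THEN act_stableD]
      by (auto simp: act_join join_cells_simps Let_def simp del: One_nat_def)
  qed (use \<alpha> assms[THEN act_stableD] in \<open>auto simp: act_join join_cells_simps\<close>)
qed

lemma join_inr_maps: "act_stable Y \<Longrightarrow> join_inr Y \<in> sset_maps Y (join X Y)"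
  by (intro sset_mapsI) (auto simp: join_inr_def act_join join_cells_simps act_stableD)

lemma join_map_simps:
  "x \<in> cells X n \<Longrightarrow> join_map X Y h n (JoinL x) = JoinL (h n x)"
  "y \<in> cells Y n \<Longrightarrow> join_map X Y h n (JoinR y) = JoinR y"
  "i < n \<Longrightarrow> x \<in> cells X i \<Longrightarrow> y \<in> cells Y (n - 1 - i) \<Longrightarrow>
    join_map X Y h n (JoinLR i x y) = JoinLR i (h i x) y"
  by (simp_all add: join_map_def join_cells_simps)

text \<open>\<open>join_map\<close> keeps the index \<open>i\<close> of a mixed cell, so an operator
  is split in the same way before and after it; on the left part naturality of \<open>h\<close>
  remains.\<close>

lemma join_map_maps:
  assumes X: "act_stable X" and Y: "act_stable Y" and h: "h \<in> sset_maps X X'"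
  shows "join_map X Y h \<in> sset_maps (join X Y) (join X' Y)"
proof (rule sset_mapsI)
  fix n c assume "c \<in> cells (join X Y) n"
  thus "join_map X Y h n c \<in> cells (join X' Y) n"
    by (cases rule: join_cells_cases) (auto simp: join_map_simps join_cells_simps sset_maps_cell[OF h])
next
  fix m n \<alpha> c assume \<alpha>: "\<alpha> \<in> ops m n" and "c \<in> cells (join X Y) n"
  from this(2) show "join_map X Y h m (act (join X Y) n \<alpha> c) = act (join X' Y) n \<alpha> (join_map X Y h n c)"
  proof (cases rule: join_cells_cases)
    case (LR i x y)
    thus ?thesis
      using ops_split[OF \<alpha> LR(2)]
      by (auto simp: act_join join_map_simps Let_def act_stableD[OF X] act_stableD[OF Y]
          sset_maps_act[OF h] simp del: One_nat_def)
  qed (use \<alpha> in \<open>auto simp: act_join join_map_simps act_stableD[OF X] act_stableD[OF Y] sset_maps_act[OF h]\<close>)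
qed (simp add: join_map_def)

section \<open>Slices and their projection to the base\<close>

lemma slice_cells:
  "\<sigma> \<in> cells (slice Q K e) n \<longleftrightarrow>
    \<sigma> \<in> sset_maps (join (std_simplex n) K) Q \<and> sset_comp K \<sigma> (join_inr K) = e"
  by (simp add: slice_def)

lemma slice_cell_JoinR:
  assumes "\<sigma> \<in> cells (slice Q K e) n" "y \<in> cells K m"
  shows "\<sigma> m (JoinR y) = e m y"
proof -
  have "sset_comp K \<sigma> (join_inr K) m y = e m y" using assms(1) by (simp add: slice_cells)
  thus ?thesis using assms(2) by (simp add: sset_comp_apply join_inr_def)
qed

lemma join_simplex_act_stable: "act_stable K \<Longrightarrow> act_stable (join (std_simplex n) K)"
  by (rule join_act_stable[OF simplicial_set_act_stable[OF std_simplex_simplicial]])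

lemma join_simplex_map_maps:
  assumes "act_stable K" "\<alpha> \<in> ops m n"
  shows "join_map (std_simplex m) K (std_simplex_map \<alpha>)
    \<in> sset_maps (join (std_simplex m) K) (join (std_simplex n) K)"
  using assms
  by (intro join_map_maps std_simplex_map_maps simplicial_set_act_stable[OF std_simplex_simplicial])

lemma act_slice:
  assumes "\<alpha> \<in> ops m n"
  shows "act (slice Q K e) n \<alpha> \<sigma> = sset_comp (join (std_simplex m) K) \<sigma>
    (join_map (std_simplex m) K (std_simplex_map \<alpha>))"
  using op_dom_ops[OF assms] by (simp add: slice_def)

text \<open>Precomposition with \<open>join_map\<close> leaves the right summand alone, so the
  restriction to \<open>K\<close> stays \<open>e\<close>.\<close>

lemma act_slice_cell:
  assumes K: "act_stable K" and \<alpha>: "\<alpha> \<in> ops m n" and \<sigma>: "\<sigma> \<in> cells (slice Q K e) n"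
  shows "act (slice Q K e) n \<alpha> \<sigma> \<in> cells (slice Q K e) m"
proof -
  have "sset_comp K (act (slice Q K e) n \<alpha> \<sigma>) (join_inr K) = sset_comp K \<sigma> (join_inr K)"
    by (auto simp: fun_eq_iff act_slice[OF \<alpha>] sset_comp_def compose_def join_inr_def
        join_map_simps join_cells_simps restrict_def)
  moreover have "act (slice Q K e) n \<alpha> \<sigma> \<in> sset_maps (join (std_simplex m) K) Q"
    using \<sigma> unfolding act_slice[OF \<alpha>] slice_cells
    by (blast intro: sset_comp_maps join_simplex_act_stable join_simplex_map_maps K \<alpha>)
  ultimately show ?thesis using \<sigma> by (simp add: slice_cells)
qed

text \<open>On cells with a left part this is associativity of operator composition; cells of
  \<open>K\<close> are fixed.\<close>

lemma join_simplex_map_comp: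
  assumes \<alpha>: "\<alpha> \<in> ops k m" and \<beta>: "\<beta> \<in> ops m n" and c: "c \<in> cells (join (std_simplex k) K) j"
  shows "join_map (std_simplex m) K (std_simplex_map \<beta>) j
      (join_map (std_simplex k) K (std_simplex_map \<alpha>) j c)
    = join_map (std_simplex k) K (std_simplex_map (op_comp \<beta> \<alpha>)) j c"
  using c op_comp_ops[OF \<alpha> \<beta>]
  by (cases rule: join_cells_cases)
    (auto simp: join_map_simps std_simplex_map_def std_simplex_def op_dom_ops[OF \<alpha>]
      op_dom_ops[OF \<beta>] op_dom_ops op_comp_ops[OF _ \<alpha>] op_comp_assoc[OF _ \<alpha>])

lemma join_simplex_map_id:
  assumes "c \<in> cells (join (std_simplex n) K) j"
  shows "join_map (std_simplex n) K (std_simplex_map (op_id n)) j c = c"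
  using assms
  by (cases rule: join_cells_cases)
    (auto simp: join_map_simps std_simplex_map_def std_simplex_def op_dom_ops[OF op_id_ops]
      op_comp_id_left)

text \<open>Both sides of each operator law are maps out of the same join, so they are compared on
  cells, where the law is the matching one for \<open>join_map\<close>.\<close>

lemma slice_simplicial:
  assumes K: "act_stable K"
  shows "simplicial_set (slice Q K e)"
proof
  fix \<alpha> m n \<sigma> assume "\<alpha> \<in> ops m n" "\<sigma> \<in> cells (slice Q K e) n"
  thus "act (slice Q K e) n \<alpha> \<sigma> \<in> cells (slice Q K e) m" by (rule act_slice_cell[OF K])
next
  fix \<sigma> n assume \<sigma>: "\<sigma> \<in> cells (slice Q K e) n"
  show "act (slice Q K e) n (op_id n) \<sigma> = \<sigma>"
  proof (rule sset_maps_eqI)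
    show "act (slice Q K e) n (op_id n) \<sigma> \<in> sset_maps (join (std_simplex n) K) Q"
      using act_slice_cell[OF K op_id_ops \<sigma>] by (simp add: slice_cells)
    show "\<sigma> \<in> sset_maps (join (std_simplex n) K) Q" using \<sigma> by (simp add: slice_cells)
  qed (simp add: act_slice[OF op_id_ops] sset_comp_apply join_simplex_map_id)
next
  fix \<alpha> k m \<beta> n \<sigma> assume \<alpha>: "\<alpha> \<in> ops k m" and \<beta>: "\<beta> \<in> ops m n" and \<sigma>: "\<sigma> \<in> cells (slice Q K e) n"
  note \<beta>\<alpha> = op_comp_ops[OF \<alpha> \<beta>]
  show "act (slice Q K e) n (op_comp \<beta> \<alpha>) \<sigma> = act (slice Q K e) m \<alpha> (act (slice Q K e) n \<beta> \<sigma>)"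
  proof (rule sset_maps_eqI)
    show "act (slice Q K e) n (op_comp \<beta> \<alpha>) \<sigma> \<in> sset_maps (join (std_simplex k) K) Q"
      using act_slice_cell[OF K \<beta>\<alpha> \<sigma>] by (simp add: slice_cells)
    show "act (slice Q K e) m \<alpha> (act (slice Q K e) n \<beta> \<sigma>) \<in> sset_maps (join (std_simplex k) K) Q"
      using act_slice_cell[OF K \<alpha> act_slice_cell[OF K \<beta> \<sigma>]] by (simp add: slice_cells)
  qed (simp add: act_slice[OF \<alpha>] act_slice[OF \<beta>] act_slice[OF \<beta>\<alpha>] sset_comp_apply
      join_simplex_map_comp[OF \<alpha> \<beta>] sset_maps_cell[OF join_simplex_map_maps[OF K \<alpha>]])
qed

text \<open>By Yoneda, the restriction of a cone to the simplex is recorded as a single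
  \<open>n\<close>-cell of \<open>Q\<close>, its value at the identity operator.\<close>

definition slice_proj :: "'q sset \<Rightarrow> 'k sset \<Rightarrow> (nat \<Rightarrow> 'k \<Rightarrow> 'q)
    \<Rightarrow> nat \<Rightarrow> (nat \<Rightarrow> (nat list, 'k) join_cell \<Rightarrow> 'q) \<Rightarrow> 'q" where
  "slice_proj Q K e n = (\<lambda>\<sigma>\<in>cells (slice Q K e) n. \<sigma> n (JoinL (op_id n)))"

text \<open>Both sides of naturality equal \<sigma> at \<open>JoinL \<alpha>\<close>: the operator
  \<alpha> is the image of \<open>op_id m\<close> under \<open>std_simplex_map \<alpha>\<close> and
  also the face of \<open>op_id n\<close> along \<alpha>.\<close>

lemma slice_proj_maps:
  assumes K: "act_stable K"
  shows "slice_proj Q K e \<in> sset_maps (slice Q K e) Q"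
proof (rule sset_mapsI)
  have id_cell: "JoinL (op_id n) \<in> cells (join (std_simplex n) K) n" for n
    using op_id_ops by (simp add: join_cells_simps std_simplex_def)
  fix n \<sigma> assume \<sigma>: "\<sigma> \<in> cells (slice Q K e) n"
  hence \<sigma>m: "\<sigma> \<in> sset_maps (join (std_simplex n) K) Q" by (simp add: slice_cells)
  show "slice_proj Q K e n \<sigma> \<in> cells Q n"
    using \<sigma> sset_maps_cell[OF \<sigma>m id_cell] by (simp add: slice_proj_def)
  fix m \<alpha> assume \<alpha>: "\<alpha> \<in> ops m n"
  have "slice_proj Q K e m (act (slice Q K e) n \<alpha> \<sigma>) = \<sigma> m (JoinL \<alpha>)"
    using act_slice_cell[OF K \<alpha> \<sigma>] op_id_ops id_cell
    by (simp add: slice_proj_def act_slice[OF \<alpha>] sset_comp_apply join_map_simps std_simplex_def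
        std_simplex_map_def op_dom_ops[OF \<alpha>] op_comp_id_right[OF \<alpha>])
  also have "\<dots> = act Q n \<alpha> (\<sigma> n (JoinL (op_id n)))"
    using sset_maps_act[OF \<sigma>m \<alpha> id_cell] op_comp_id_left[OF \<alpha>]
    by (simp add: act_join) (simp add: std_simplex_def)
  finally show "slice_proj Q K e m (act (slice Q K e) n \<alpha> \<sigma>) = act Q n \<alpha> (slice_proj Q K e n \<sigma>)"
    using \<sigma> by (simp add: slice_proj_def)
qed (simp add: slice_proj_def)

subsection \<open>Pushouts\<close>

text \<open>The generating relation is closed under converse, so its closure is symmetric; the
  intersection cuts reflexivity down to the disjoint union.\<close>

lemma equiv_pushout_rel: "equiv (cells X n <+> cells Y n) (pushout_rel Z X Y f g n)"
proof -
  let ?R = "{(Inl (f n z), Inr (g n z)) |z. z \<in> cells Z n}"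
  have "sym ((?R \<union> ?R\<inverse>)\<^sup>*)" by (simp add: sym_Un_converse sym_rtrancl)
  thus ?thesis
    unfolding pushout_rel_def Let_def
    by (intro equivI) (auto simp: refl_on_def sym_on_def trans_on_def)
qed

lemma pushout_rel_glue:
  assumes "f \<in> sset_maps Z X" "g \<in> sset_maps Z Y" "z \<in> cells Z n"
  shows "(Inl (f n z), Inr (g n z)) \<in> pushout_rel Z X Y f g n"
  using assms sset_maps_cell[OF assms(1,3)] sset_maps_cell[OF assms(2,3)]
  unfolding pushout_rel_def Let_def by blast

text \<open>The principle behind every well-definedness check on classes: a function respecting the
  generating pairs is constant along zigzags of them.\<close>

lemma pushout_rel_induct:
  assumes "(a, b) \<in> pushout_rel Z X Y f g n"
    and glue: "\<And>z. z \<in> cells Z n \<Longrightarrow> \<phi> (Inl (f n z)) = \<phi> (Inr (g n z))"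
  shows "\<phi> a = \<phi> b"
proof -
  let ?R = "{(Inl (f n z), Inr (g n z)) |z. z \<in> cells Z n}"
  have "(a, b) \<in> (?R \<union> ?R\<inverse>)\<^sup>*" using assms(1) by (simp add: pushout_rel_def Let_def)
  thus ?thesis by (induction rule: rtrancl_induct) (use glue in auto)
qed

text \<open>Operators on pushouts and \<open>wjoin_map\<close> are defined by mapping a whole class
  and saturating; this reduces them to one representative.\<close>

lemma equiv_image_class:
  assumes "equiv A r" "a \<in> A" and \<phi>: "\<And>b. (a, b) \<in> r \<Longrightarrow> s `` {\<phi> a} = s `` {\<phi> b}"
  shows "s `` (\<phi> ` (r `` {a})) = s `` {\<phi> a}"
proof -
  have "a \<in> r `` {a}" using assms(1,2) by (rule equiv_class_self)
  moreover have "s `` {\<phi> b} = s `` {\<phi> a}" if "b \<in> r `` {a}" for b using \<phi> that by auto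
  ultimately show ?thesis by blast
qed

locale sset_span =
  fixes Z :: "'z sset" and X :: "'x sset" and Y :: "'y sset"
    and f :: "nat \<Rightarrow> 'z \<Rightarrow> 'x" and g :: "nat \<Rightarrow> 'z \<Rightarrow> 'y"
  assumes Z: "act_stable Z" and X: "act_stable X" and Y: "act_stable Y"
    and f: "f \<in> sset_maps Z X" and g: "g \<in> sset_maps Z Y"
begin

abbreviation "P \<equiv> pushout Z X Y f g"
abbreviation "inl \<equiv> pushout_inl Z X Y f g"
abbreviation "inr \<equiv> pushout_inr Z X Y f g"
abbreviation "rel \<equiv> pushout_rel Z X Y f g"

lemmas rel_equiv = equiv_pushout_rel[of X _ Y Z f g]

lemma pushout_cases:
  assumes "C \<in> cells P n"
  obtains (inl) x where "x \<in> cells X n" "C = inl n x" | (inr) y where "y \<in> cells Y n" "C = inr n y"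
  using assms by (auto simp: pushout_def pushout_inl_def pushout_inr_def elim!: quotientE)

lemma inl_cell: "x \<in> cells X n \<Longrightarrow> inl n x \<in> cells P n"
  by (auto simp: pushout_def pushout_inl_def intro: quotientI)

lemma inr_cell: "y \<in> cells Y n \<Longrightarrow> inr n y \<in> cells P n"
  by (auto simp: pushout_def pushout_inr_def intro: quotientI)

lemma glue_class: "z \<in> cells Z n \<Longrightarrow> rel n `` {Inl (f n z)} = rel n `` {Inr (g n z)}"
  by (rule equiv_class_eq[OF rel_equiv pushout_rel_glue[OF f g]])

text \<open>By naturality of \<open>f\<close> and \<open>g\<close>, the pair glued over
  \<open>z\<close> is sent to the pair glued over \<open>act Z n \<alpha> z\<close>.\<close>

lemma act_class:
  assumes \<alpha>: "\<alpha> \<in> ops m n" and a: "a \<in> cells X n <+> cells Y n"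
  shows "act P n \<alpha> (rel n `` {a}) = rel m `` {map_sum (act X n \<alpha>) (act Y n \<alpha>) a}"
proof -
  have "rel m `` {map_sum (act X n \<alpha>) (act Y n \<alpha>) a} = rel m `` {map_sum (act X n \<alpha>) (act Y n \<alpha>) b}"
    if "(a, b) \<in> rel n" for b
    using that
    by (rule pushout_rel_induct)
      (simp add: glue_class act_stableD[OF Z \<alpha>] flip: sset_maps_act[OF f \<alpha>] sset_maps_act[OF g \<alpha>])
  hence "rel m `` (map_sum (act X n \<alpha>) (act Y n \<alpha>) ` (rel n `` {a}))
      = rel m `` {map_sum (act X n \<alpha>) (act Y n \<alpha>) a}"
    by (rule equiv_image_class[OF rel_equiv a])
  thus ?thesis by (simp add: pushout_def op_dom_ops[OF \<alpha>])
qed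

lemma inl_maps: "inl \<in> sset_maps X P"
  by (intro sset_mapsI)
    (simp_all add: inl_cell, simp_all add: pushout_inl_def act_stableD[OF X] act_class InlI)

lemma inr_maps: "inr \<in> sset_maps Y P"
  by (intro sset_mapsI)
    (simp_all add: inr_cell, simp_all add: pushout_inr_def act_stableD[OF Y] act_class InrI)

lemma glue: "z \<in> cells Z n \<Longrightarrow> inl n (f n z) = inr n (g n z)"
  by (simp add: pushout_inl_def pushout_inr_def glue_class sset_maps_cell[OF f] sset_maps_cell[OF g])

text \<open>The map out of the pushout given by its universal property. It evaluates at a chosen
  representative; the choice is immaterial once \<open>u\<close> and \<open>v\<close> agree on
  \<open>Z\<close>.\<close>

definition copair :: "(nat \<Rightarrow> 'x \<Rightarrow> 'a) \<Rightarrow> (nat \<Rightarrow> 'y \<Rightarrow> 'a) \<Rightarrow> nat \<Rightarrow> ('x + 'y) set \<Rightarrow> 'a" where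
  "copair u v n = (\<lambda>C\<in>cells P n. case_sum (u n) (v n) (SOME a. a \<in> C))"

context
  fixes u v
  assumes compat: "\<And>n z. z \<in> cells Z n \<Longrightarrow> u n (f n z) = v n (g n z)"
begin

lemma copair_class:
  assumes a: "a \<in> cells X n <+> cells Y n"
  shows "copair u v n (rel n `` {a}) = case_sum (u n) (v n) a"
proof -
  have "a \<in> rel n `` {a}" by (rule equiv_class_self[OF rel_equiv a])
  hence "(SOME b. b \<in> rel n `` {a}) \<in> rel n `` {a}" by (rule someI)
  hence "(a, SOME b. b \<in> rel n `` {a}) \<in> rel n" by blast
  hence "case_sum (u n) (v n) a = case_sum (u n) (v n) (SOME b. b \<in> rel n `` {a})"
    by (rule pushout_rel_induct) (simp add: compat)
  moreover have "rel n `` {a} \<in> cells P n"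
    using a by (auto simp: pushout_def intro: quotientI)
  ultimately show ?thesis by (simp add: copair_def)
qed

lemma copair_inl: "x \<in> cells X n \<Longrightarrow> copair u v n (inl n x) = u n x"
  using copair_class[of "Inl x"] by (simp add: pushout_inl_def InlI)

lemma copair_inr: "y \<in> cells Y n \<Longrightarrow> copair u v n (inr n y) = v n y"
  using copair_class[of "Inr y"] by (simp add: pushout_inr_def InrI)

lemma copair_maps:
  assumes u: "u \<in> sset_maps X T" and v: "v \<in> sset_maps Y T"
  shows "copair u v \<in> sset_maps P T"
proof (rule sset_mapsI)
  fix n C assume "C \<in> cells P n"
  thus "copair u v n C \<in> cells T n"
    by (cases rule: pushout_cases)
      (simp_all add: copair_inl copair_inr sset_maps_cell[OF u] sset_maps_cell[OF v])
next
  fix m n \<alpha> C assume \<alpha>: "\<alpha> \<in> ops m n" and "C \<in> cells P n"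
  from this(2) show "copair u v m (act P n \<alpha> C) = act T n \<alpha> (copair u v n C)"
    by (cases rule: pushout_cases)
      (simp_all add: copair_inl copair_inr act_stableD[OF X \<alpha>] act_stableD[OF Y \<alpha>]
        sset_maps_act[OF u \<alpha>] sset_maps_act[OF v \<alpha>]
        flip: sset_maps_act[OF inl_maps \<alpha>] sset_maps_act[OF inr_maps \<alpha>])
qed (simp add: copair_def)

end

end

subsection \<open>Weighted cones\<close>

locale weighted_diagram =
  fixes Q :: "'q sset" and K :: "'k sset" and J :: "'j sset"
    and p :: "nat \<Rightarrow> 'k \<Rightarrow> 'j" and d :: "nat \<Rightarrow> 'j \<Rightarrow> 'q"
  assumes K: "act_stable K" and J: "act_stable J"
    and p: "p \<in> sset_maps K J" and d: "d \<in> sset_maps J Q"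
begin

abbreviation "e \<equiv> sset_comp K d p"
abbreviation "S \<equiv> slice Q K e"
abbreviation "W \<equiv> wslice Q K J p d"

text \<open>One span for each \<open>n\<close>; its pushout \<open>wj.P n\<close> is the weighted
  join of the \<open>n\<close>-simplex with \<open>J\<close>.\<close>

sublocale wj: sset_span K "join (std_simplex n) K" J "join_inr K" p for n
  by unfold_locales (intro K J p join_simplex_act_stable join_inr_maps)+

text \<open>Glued pairs are preserved, since \<open>join_map\<close> fixes the cells of
  \<open>K\<close> and \<open>sset_id\<close> fixes those of \<open>J\<close>.\<close>

lemma wjoin_map_class:
  assumes \<alpha>: "\<alpha> \<in> ops m n" and a: "a \<in> cells (join (std_simplex m) K) k <+> cells J k"
  shows "wjoin_map (std_simplex m) (std_simplex n) K J p (std_simplex_map \<alpha>) k (wj.rel m k `` {a})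
    = wj.rel n k `` {map_sum (join_map (std_simplex m) K (std_simplex_map \<alpha>) k) (sset_id J k) a}"
    (is "?l = _ `` {?\<phi> a}")
proof -
  have "wj.rel n k `` {?\<phi> a} = wj.rel n k `` {?\<phi> b}" if "(a, b) \<in> wj.rel m k" for b
    using that
  proof (rule pushout_rel_induct)
    fix z assume z: "z \<in> cells K k"
    show "wj.rel n k `` {?\<phi> (Inl (join_inr K k z))} = wj.rel n k `` {?\<phi> (Inr (p k z))}"
      using wj.glue_class[OF z] sset_maps_cell[OF p z] z
      by (simp add: join_inr_def join_map_simps sset_id_def)
  qed
  hence "wj.rel n k `` (?\<phi> ` (wj.rel m k `` {a})) = wj.rel n k `` {?\<phi> a}"
    by (rule equiv_image_class[OF wj.rel_equiv a])
  moreover have "wj.rel m k `` {a} \<in> cells (wjoin (std_simplex m) K J p) k"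
    using a by (auto simp: wjoin_def pushout_def intro: quotientI)
  ultimately show ?thesis by (simp add: wjoin_map_def)
qed

lemma wjoin_map_inl:
  assumes "\<alpha> \<in> ops m n" and x: "x \<in> cells (join (std_simplex m) K) k"
  shows "wjoin_map (std_simplex m) (std_simplex n) K J p (std_simplex_map \<alpha>) k (wj.inl m k x)
    = wj.inl n k (join_map (std_simplex m) K (std_simplex_map \<alpha>) k x)"
  using wjoin_map_class[OF assms(1) InlI[OF x]] x
    sset_maps_cell[OF join_simplex_map_maps[OF K assms(1)] x]
  by (simp add: pushout_inl_def)

lemma wjoin_map_inr:
  assumes "\<alpha> \<in> ops m n" and y: "y \<in> cells J k"
  shows "wjoin_map (std_simplex m) (std_simplex n) K J p (std_simplex_map \<alpha>) k (wj.inr m k y)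
    = wj.inr n k y"
  using wjoin_map_class[OF assms(1) InrI[OF y]] y by (simp add: pushout_inr_def sset_id_def)

lemma wslice_cells:
  "\<sigma> \<in> cells W n \<longleftrightarrow> \<sigma> \<in> sset_maps (wj.P n) Q \<and> (\<forall>m. \<forall>y\<in>cells J m. \<sigma> m (wj.inr n m y) = d m y)"
proof -
  have "sset_comp J \<sigma> (wj.inr n) = d \<longleftrightarrow> (\<forall>m. \<forall>y\<in>cells J m. \<sigma> m (wj.inr n m y) = d m y)"
    using sset_maps_undefined[OF d]
    by (auto simp: fun_eq_iff sset_comp_def compose_def restrict_def)
  thus ?thesis by (simp add: wslice_def wjoin_def wjoin_inr_def)
qed

text \<open>This is the gluing condition that \<open>wj.copair n \<sigma> d\<close>
  requires.\<close>

lemma slice_compat: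
  assumes "\<sigma> \<in> cells S n" "z \<in> cells K m"
  shows "\<sigma> m (join_inr K m z) = d m (p m z)"
  using slice_cell_JoinR[OF assms] assms(2) by (simp add: join_inr_def sset_comp_apply)

text \<open>Extends a cone over \<open>e\<close> to the weighted join by \<open>d\<close> on
  \<open>J\<close>.\<close>

definition to_wslice where
  "to_wslice n = (\<lambda>\<sigma>\<in>cells S n. wj.copair n \<sigma> d)"

lemma to_wslice_inl:
  "\<sigma> \<in> cells S n \<Longrightarrow> x \<in> cells (join (std_simplex n) K) m \<Longrightarrow>
    to_wslice n \<sigma> m (wj.inl n m x) = \<sigma> m x"
  by (simp add: to_wslice_def wj.copair_inl slice_compat)

lemma to_wslice_inr:
  "\<sigma> \<in> cells S n \<Longrightarrow> y \<in> cells J m \<Longrightarrow> to_wslice n \<sigma> m (wj.inr n m y) = d m y"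
  by (simp add: to_wslice_def wj.copair_inr slice_compat)

lemma to_wslice_cell: "\<sigma> \<in> cells S n \<Longrightarrow> to_wslice n \<sigma> \<in> cells W n"
  using wj.copair_maps[where n = n and u = \<sigma> and v = d and T = Q] d
  by (simp add: wslice_cells to_wslice_inr) (simp add: to_wslice_def slice_compat slice_cells)

text \<open>The two legs cover the pushout, and on \<open>J\<close> both cones are
  \<open>d\<close>.\<close>

lemma wslice_cell_eqI:
  assumes "\<sigma> \<in> cells W n" "\<tau> \<in> cells W n"
    and "\<And>m x. x \<in> cells (join (std_simplex n) K) m \<Longrightarrow> \<sigma> m (wj.inl n m x) = \<tau> m (wj.inl n m x)"
  shows "\<sigma> = \<tau>"
proof (rule sset_maps_eqI)
  fix m C assume "C \<in> cells (wj.P n) m"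
  thus "\<sigma> m C = \<tau> m C"
    using assms by (cases rule: wj.pushout_cases) (auto simp: wslice_cells)
qed (use assms in \<open>auto simp: wslice_cells\<close>)

lemma act_wslice:
  assumes "\<alpha> \<in> ops m n"
  shows "act W n \<alpha> \<sigma> = sset_comp (wj.P m) \<sigma>
    (wjoin_map (std_simplex m) (std_simplex n) K J p (std_simplex_map \<alpha>))"
  using op_dom_ops[OF assms] by (simp add: wslice_def wjoin_def)

text \<open>Compared on the two legs: on the left one both sides are \<sigma> after
  \<open>join_map\<close>, on the right one both are \<open>d\<close>.\<close>

lemma to_wslice_maps: "to_wslice \<in> sset_maps S W"
proof (rule sset_mapsI)
  fix m n \<alpha> \<sigma> assume \<alpha>: "\<alpha> \<in> ops m n" and \<sigma>: "\<sigma> \<in> cells S n"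
  note a\<sigma> = act_slice_cell[OF K \<alpha> \<sigma>]
  note jm = sset_maps_cell[OF join_simplex_map_maps[OF K \<alpha>]]
  show "to_wslice m (act S n \<alpha> \<sigma>) = act W n \<alpha> (to_wslice n \<sigma>)"
  proof (intro ext)
    fix k C
    show "to_wslice m (act S n \<alpha> \<sigma>) k C = act W n \<alpha> (to_wslice n \<sigma>) k C"
    proof (cases "C \<in> cells (wj.P m) k")
      case True
      thus ?thesis
        using \<sigma> a\<sigma> jm
        by (cases rule: wj.pushout_cases)
          (simp_all add: act_wslice[OF \<alpha>] sset_comp_apply wj.inl_cell wj.inr_cell
            wjoin_map_inl[OF \<alpha>] wjoin_map_inr[OF \<alpha>] to_wslice_inl to_wslice_inr act_slice[OF \<alpha>])
    next
      case False
      thus ?thesis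
        using to_wslice_cell[OF a\<sigma>] sset_maps_undefined[of _ "wj.P m" Q C k]
        by (simp add: act_wslice[OF \<alpha>] sset_comp_undefined wslice_cells)
    qed
  qed
qed (simp_all add: to_wslice_cell, simp add: to_wslice_def)

text \<open>Restriction along the left leg recovers the original cone, which gives injectivity and
  also the preimages.\<close>

lemma to_wslice_bij: "bij_betw (to_wslice n) (cells S n) (cells W n)"
proof (rule bij_betw_imageI)
  show "inj_on (to_wslice n) (cells S n)"
  proof (rule inj_onI)
    fix \<sigma> \<tau> assume \<sigma>: "\<sigma> \<in> cells S n" and \<tau>: "\<tau> \<in> cells S n" and "to_wslice n \<sigma> = to_wslice n \<tau>"
    hence "\<sigma> m x = \<tau> m x" if "x \<in> cells (join (std_simplex n) K) m" for m x
      using that by (metis to_wslice_inl)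
    thus "\<sigma> = \<tau>" using \<sigma> \<tau> unfolding slice_cells by (blast intro: sset_maps_eqI)
  qed
  have "\<sigma> \<in> to_wslice n ` cells S n" if \<sigma>: "\<sigma> \<in> cells W n" for \<sigma>
  proof
    have \<sigma>m: "\<sigma> \<in> sset_maps (wj.P n) Q" using \<sigma> by (simp add: wslice_cells)
    \<comment> \<open>On cells of \<open>K\<close> the gluing turns \<sigma> into its value on
      \<open>J\<close>, so \<tau> restricts to \<open>e\<close> there.\<close>
    define \<tau> where "\<tau> = sset_comp (join (std_simplex n) K) \<sigma> (wj.inl n)"
    have "\<tau> m (join_inr K m z) = d m (p m z)" if "z \<in> cells K m" for m z
      using that \<sigma> sset_maps_cell[OF join_inr_maps[OF K, of "std_simplex n"] that] sset_maps_cell[OF p that]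
      by (simp add: \<tau>_def sset_comp_apply wj.glue wslice_cells)
    hence "sset_comp K \<tau> (join_inr K) = e"
      by (auto simp: fun_eq_iff sset_comp_def compose_def restrict_def)
    hence \<tau>: "\<tau> \<in> cells S n"
      using sset_comp_maps[OF join_simplex_act_stable[OF K] wj.inl_maps \<sigma>m]
      by (simp add: slice_cells \<tau>_def)
    thus "\<tau> \<in> cells S n" .
    show "\<sigma> = to_wslice n \<tau>"
      using \<sigma> to_wslice_cell[OF \<tau>]
      by (rule wslice_cell_eqI) (simp add: to_wslice_inl[OF \<tau>], simp add: \<tau>_def sset_comp_apply)
  qed
  thus "to_wslice n ` cells S n = cells W n" using to_wslice_cell by blast
qed

section \<open>Comparison of weighted and ordinary limits\<close>

text \<open>The conditions on the cone say that \<open>c\<close> is a vertex of the slice, which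
  \<open>terminal\<close> contains; the apex is the projection of that vertex.\<close>

lemma is_limit_iff: "is_limit Q K e l c \<longleftrightarrow> terminal S c \<and> slice_proj Q K e 0 c = l"
proof (cases "c \<in> cells S 0")
  case True
  have v: "[0] \<in> cells (std_simplex 0) 0" by (simp add: std_simplex_def ops_def)
  have "slice_proj Q K e 0 c = sset_comp (std_simplex 0) c (join_inl (std_simplex 0)) 0 [0]"
    using True v by (simp add: slice_proj_def sset_comp_apply join_inl_def op_id_def)
  thus ?thesis
    using True sset_maps_cell[OF slice_proj_maps[OF K] True] by (auto simp: is_limit_def slice_cells)
next
  case False
  thus ?thesis by (auto simp: is_limit_def terminal_def slice_cells)
qed

text \<open>The extended cone agrees with \<open>c\<close> on the left leg, so it has the same
  apex.\<close>

lemma is_weighted_limit_to_wslice_iff: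
  assumes c: "c \<in> cells S 0"
  shows "is_weighted_limit Q K J p d l (to_wslice 0 c)
    \<longleftrightarrow> terminal W (to_wslice 0 c) \<and> slice_proj Q K e 0 c = l"
proof -
  have v: "[0] \<in> cells (std_simplex 0) 0" by (simp add: std_simplex_def ops_def)
  hence "JoinL [0] \<in> cells (join (std_simplex 0) K) 0" by (simp add: join_cells_simps)
  hence "slice_proj Q K e 0 c
      = sset_comp (std_simplex 0) (to_wslice 0 c) (wjoin_inl (std_simplex 0) K J p) 0 [0]"
    using c v
    by (simp add: slice_proj_def sset_comp_apply wjoin_inl_def join_inl_def op_id_def to_wslice_inl)
  moreover have "to_wslice 0 c \<in> sset_maps (wjoin (std_simplex 0) K J p) Q"
    "sset_comp J (to_wslice 0 c) (wjoin_inr (std_simplex 0) K J p) = d"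
    using to_wslice_cell[OF c] by (simp_all add: wslice_def)
  ultimately show ?thesis
    using sset_maps_cell[OF slice_proj_maps[OF K] c] by (auto simp: is_weighted_limit_def)
qed

lemma terminal_to_wslice_iff:
  assumes c: "c \<in> cells S 0"
  shows "terminal W (to_wslice 0 c) \<longleftrightarrow> terminal S c"
proof -
  have "act_stable S" by (rule simplicial_set_act_stable[OF slice_simplicial[OF K]])
  from sset_iso_inverse[OF this to_wslice_maps to_wslice_bij]
  obtain h where h: "h \<in> sset_maps W S"
    and hw: "\<And>n \<sigma>. \<sigma> \<in> cells S n \<Longrightarrow> h n (to_wslice n \<sigma>) = \<sigma>"
    and wh: "\<And>n \<sigma>. \<sigma> \<in> cells W n \<Longrightarrow> to_wslice n (h n \<sigma>) = \<sigma>"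
    by blast
  show ?thesis
  proof
    assume "terminal W (to_wslice 0 c)"
    hence "terminal S (h 0 (to_wslice 0 c))"
      by (intro terminal_iso[OF h to_wslice_maps]) (simp_all add: wh hw)
    thus "terminal S c" by (simp add: hw[OF c])
  next
    assume "terminal S c"
    thus "terminal W (to_wslice 0 c)"
      by (intro terminal_iso[OF to_wslice_maps h]) (simp_all add: wh hw)
  qed
qed

lemma is_weighted_limit_iff:
  "is_weighted_limit Q K J p d l w \<longleftrightarrow> (\<exists>c. w = to_wslice 0 c \<and> is_limit Q K e l c)"
proof
  assume w: "is_weighted_limit Q K J p d l w"
  \<comment> \<open>Terminality makes \<open>w\<close> a vertex of \<open>W\<close>, and
    \<open>to_wslice 0\<close> is onto these.\<close>
  hence "w \<in> cells W 0" by (simp add: is_weighted_limit_def terminal_def)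
  then obtain c where "c \<in> cells S 0" "w = to_wslice 0 c"
    using to_wslice_bij by (auto simp: bij_betw_def)
  thus "\<exists>c. w = to_wslice 0 c \<and> is_limit Q K e l c"
    using w by (auto simp: is_weighted_limit_to_wslice_iff terminal_to_wslice_iff is_limit_iff)
next
  assume "\<exists>c. w = to_wslice 0 c \<and> is_limit Q K e l c"
  then obtain c where c: "w = to_wslice 0 c" "is_limit Q K e l c" by blast
  hence "c \<in> cells S 0" by (simp add: is_limit_iff terminal_def)
  thus "is_weighted_limit Q K J p d l w"
    using c by (simp add: is_weighted_limit_to_wslice_iff terminal_to_wslice_iff is_limit_iff)
qed

text \<open>Both cones are terminal in the same slice, hence equivalent there; the projection
  carries this to the apexes.\<close>

lemma limits_equivalent:
  assumes "is_limit Q K e l c" "is_limit Q K e l' c'"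
  shows "equivalent Q l l'"
proof -
  have "equivalent S c c'"
    using assms unfolding is_limit_iff
    by (intro simplicial_set.terminal_equivalent[OF slice_simplicial[OF K]]) blast+
  from equivalent_map[OF slice_simplicial[OF K] slice_proj_maps[OF K] this] show ?thesis
    using assms by (simp add: is_limit_iff)
qed

end

theorem theoremD:
  fixes Q :: "'q sset" and K :: "'k sset" and J :: "'j sset"
    and p :: "nat \<Rightarrow> 'k \<Rightarrow> 'j" and d :: "nat \<Rightarrow> 'j \<Rightarrow> 'q"
  assumes "quasi_category Q"
    and "simplicial_set K" and "simplicial_set J"
    and "p \<in> sset_maps K J"
    and "d \<in> sset_maps J Q"
  shows "(\<forall>l. (\<exists>c. is_weighted_limit Q K J p d l c) \<longleftrightarrow>
              (\<exists>c. is_limit Q K (sset_comp K d p) l c)) \<and>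
         (\<forall>l c l' c'. is_weighted_limit Q K J p d l c \<longrightarrow>
              is_limit Q K (sset_comp K d p) l' c' \<longrightarrow> equivalent Q l l')"
proof -
  interpret weighted_diagram Q K J p d
    using assms by unfold_locales (auto simp: simplicial_set_act_stable)
  \<comment> \<open>A weighted limit cone corresponds to an ordinary one with the same apex, which
    gives the first claim and reduces the second to two ordinary limits.\<close>
  show ?thesis
    using is_weighted_limit_iff limits_equivalent by blast
qed

end
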